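(* Let $m,n \geq 1$ be integers, $k=\min(m,n)$, $Y \in \mathbb{R}^{m\times n}$, $\lambda>0$, and let $\phi(\cdot\,;a)\colon\mathbb{R}\to\mathbb{R}$ be a non-convex penalty function with parameter $a$ satisfying Assumption 1 (stated in the context). If $0 \leq a < 1/\lambda$, then the function $\Psi\colon\mathbb{R}^{m\times n}\to\mathbb{R}$ defined by $$\Psi(X) = \frac{1}{2}\|Y-X\|_F^2 + \lambda\sum_{i=1}^{k}\phi(\sigma_i(X);a)$$ is strictly convex.
   Context: $\sigma_i(X)$ denotes the $i$-th singular value of $X$ (the $k=\min(m,n)$ singular values are nonnegative, listed in nonincreasing order with multiplicity), and $\|\cdot\|_F$ is the Frobenius norm. Assumption 1. Penalty functions $\phi(\cdot\,;a)\colon\mathbb{R}\to\mathbb{R}$ are parameterized by a real number $a\geq 0$. "Non-convex penalty function" is the name used for a function satisfying the following properties (the case $a=0$, e.g. $\phi(x;0)=|x|$, is allowed); primes denote derivatives in $x$: 1. $\phi$ is continuous on $\mathbb{R}$, continuously differentiable on $\mathbb{R}\setminus\{0\}$, and symmetric, i.e. $\phi(-x;a)=\phi(x;a)$; 2. $\phi'(x;a)\geq 0$ for all $x>0$; 3. $\phi''(x;a)\leq 0$ for all $x>0$; 4. $\phi'(0^+;a)=1$; 5. $\inf_{x\neq 0}\phi''(x;a)=\phi''(0^+;a)=-a$. *)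

theory Defs
  imports "HOL-Analysis.Analysis" "HOL-Computational_Algebra.Polynomial"
begin

text \<open>
  A real \<open>m \<times> n\<close> matrix is an element of \<^typ>\<open>real^'n^'m\<close>, with \<open>m = CARD('m)\<close> rows and
  \<open>n = CARD('n)\<close> columns. The library norm on this type is the Frobenius norm:
\<close>

lemma norm_matrix_eq_frobenius:
  fixes X :: "real^'n^'m"
  shows "norm X = sqrt (\<Sum>i\<in>UNIV. \<Sum>j\<in>UNIV. (X $ i $ j)\<^sup>2)"
  by (simp add: norm_vec_def L2_set_def sum_nonneg)

definition charpoly :: "real^'n^'n \<Rightarrow> real poly" where
  "charpoly A = det (\<chi> i j. (if i = j then [:0, 1:] else 0) - [:A $ i $ j:])"

text \<open>
  Real eigenvalues in nonincreasing order, repeated according to algebraic multiplicity.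
  For symmetric \<open>A\<close> these are all the eigenvalues, so the list has length \<open>CARD('n)\<close>.
\<close>

definition eigenvalue_list :: "real^'n^'n \<Rightarrow> real list" where
  "eigenvalue_list A = rev (sorted_list_of_multiset (proots (charpoly A)))"

text \<open>
  The \<open>i\<close>-th singular value, counted from \<open>1\<close>; it is meaningful for
  \<open>1 \<le> i \<le> min CARD('m) CARD('n)\<close>.
\<close>

definition singular_value :: "real^'n^'m \<Rightarrow> nat \<Rightarrow> real" where
  "singular_value X i = sqrt (eigenvalue_list (transpose X ** X) ! (i - 1))"

text \<open>
  The conditions on \<open>\<phi>''\<close> presuppose that \<open>\<phi>\<close> is twice differentiable away from \<open>0\<close>, which is
  made explicit. Since the infimum of a set of reals that is not bounded below is unspecified in
  HOL, boundedness is stated separately.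
\<close>

definition nonconvex_penalty :: "(real \<Rightarrow> real) \<Rightarrow> real \<Rightarrow> bool" where
  "nonconvex_penalty \<phi> a \<longleftrightarrow>
     continuous_on UNIV \<phi> \<and>
     (\<forall>x. x \<noteq> 0 \<longrightarrow> \<phi> differentiable (at x)) \<and>
     continuous_on (- {0}) (deriv \<phi>) \<and>
     (\<forall>x. \<phi> (- x) = \<phi> x) \<and>
     (\<forall>x>0. deriv \<phi> x \<ge> 0) \<and>
     (\<forall>x. x \<noteq> 0 \<longrightarrow> deriv \<phi> differentiable (at x)) \<and>
     (\<forall>x>0. deriv (deriv \<phi>) x \<le> 0) \<and>
     (deriv \<phi> \<longlongrightarrow> 1) (at_right 0) \<and>
     bdd_below (deriv (deriv \<phi>) ` (- {0})) \<and>
     (INF x\<in>- {0}. deriv (deriv \<phi>) x) = - a \<and>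
     (deriv (deriv \<phi>) \<longlongrightarrow> - a) (at_right 0)"

definition strictly_convex_on :: "'a::real_vector set \<Rightarrow> ('a \<Rightarrow> real) \<Rightarrow> bool" where
  "strictly_convex_on S f \<longleftrightarrow> convex S \<and>
     (\<forall>x\<in>S. \<forall>y\<in>S. \<forall>u>0. \<forall>v>0. x \<noteq> y \<longrightarrow> u + v = 1 \<longrightarrow>
        f (u *\<^sub>R x + v *\<^sub>R y) < u * f x + v * f y)"

end

theory Submission
  imports Defs
begin

text \<open>
  Put \<open>g x = \<phi> x - \<phi> 0 + a / 2 * x\<^sup>2\<close>. On \<open>{0..}\<close> this function is convex, because \<open>\<phi>'' \<ge> - a\<close>, and
  nondecreasing. Since the squares of the singular values add up to \<open>(norm X)\<^sup>2\<close>, up to a constant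
  the objective is \<open>1/2 * (norm (Y - X))\<^sup>2 - lam * a / 2 * (norm X)\<^sup>2\<close>, which is strictly convex as
  \<open>lam * a < 1\<close>, plus \<open>lam\<close> times the sum of \<open>g\<close> over the singular values. That sum is convex because
  it is the maximum of \<open>\<Sum>i. g \<bar>p i \<bullet> (X *v q i)\<bar>\<close> over orthonormal families \<open>p\<close> and \<open>q\<close>, and each of
  these functions is convex in \<open>X\<close>. The maximum is attained at the singular vectors; that it is an
  upper bound follows from \<open>p i \<bullet> (X *v q i) = (\<Sum>j. s j * (p i \<bullet> u j) * (q i \<bullet> v j))\<close>, where
  \<open>\<bar>(p i \<bullet> u j) * (q i \<bullet> v j)\<bar> \<le> ((p i \<bullet> u j)\<^sup>2 + (q i \<bullet> v j)\<^sup>2) / 2\<close> and the right-hand sides form a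
  doubly substochastic matrix by Bessel's inequality.
\<close>

subsection \<open>Eigenbases of symmetric matrices\<close>

text \<open>A maximiser of the Rayleigh quotient on the unit sphere of \<open>S\<close> is an
  eigenvector: otherwise moving it along the residual \<open>f x - c x\<close> would increase the
  quotient.\<close>

lemma selfadjoint_eigenvector_exists:
  fixes f :: "'a::euclidean_space \<Rightarrow> 'a"
  assumes f: "linear f" and sa: "\<And>x y. f x \<bullet> y = x \<bullet> f y"
    and S: "subspace S" and inv: "f ` S \<subseteq> S" and nz: "S \<noteq> {0}"
  obtains x c where "x \<in> S" "norm x = 1" "f x = c *\<^sub>R x"
proof -
  interpret linear f by (rule f)
  have "compact (S \<inter> sphere 0 1)"
    by (simp add: closed_Int_compact closed_subspace S)
  moreover have "S \<inter> sphere 0 1 \<noteq> {}"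
  proof -
    obtain z where "z \<in> S" "z \<noteq> 0"
      using nz S subspace_0 by blast
    then have "(1 / norm z) *\<^sub>R z \<in> S \<inter> sphere 0 1"
      using S by (simp add: subspace_scale)
    then show ?thesis by blast
  qed
  moreover have "continuous_on (S \<inter> sphere 0 1) (\<lambda>x. x \<bullet> f x)"
    by (intro continuous_intros linear_continuous_on) (simp add: f linear_conv_bounded_linear[symmetric])
  ultimately obtain x where x: "x \<in> S" "norm x = 1"
    and max: "\<forall>z\<in>S \<inter> sphere 0 1. z \<bullet> f z \<le> x \<bullet> f x"
    using continuous_attains_sup[of "S \<inter> sphere 0 1" "\<lambda>x. x \<bullet> f x"]
    by (metis Int_iff mem_sphere_0)
  define c where "c = x \<bullet> f x"
  have le: "z \<bullet> f z \<le> c * (z \<bullet> z)" if "z \<in> S" for z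
  proof (cases "z = 0")
    case False
    have "(1 / norm z) *\<^sub>R z \<in> S \<inter> sphere 0 1"
      using False S that by (simp add: subspace_scale)
    from bspec[OF max this] have "z \<bullet> f z / (norm z)\<^sup>2 \<le> c"
      by (simp add: scale c_def power2_eq_square)
    then show ?thesis
      using False by (simp add: divide_le_eq dot_square_norm mult.commute)
  qed simp
  define y where "y = f x - c *\<^sub>R x"
  have y: "y \<in> S"
    unfolding y_def using S inv x by (intro subspace_diff subspace_scale) auto
  define K where "K = c * (y \<bullet> y) - y \<bullet> f y"
  have K: "K \<ge> 0"
    using le[OF y] by (simp add: K_def)
  \<comment> \<open>Maximality tested at \<open>x + t y\<close>. The first-order terms leave exactly
    \<open>2 * t * (y \<bullet> y)\<close>, and \<open>K\<close> collects the second-order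
    ones.\<close>
  have ineq: "2 * t * (y \<bullet> y) \<le> t\<^sup>2 * K" for t
  proof -
    have "x + t *\<^sub>R y \<in> S"
      using S x y by (simp add: subspace_add subspace_scale)
    from le[OF this] have "c + 2 * t * (y \<bullet> f x) + t\<^sup>2 * (y \<bullet> f y)
        \<le> c * (1 + 2 * t * (x \<bullet> y) + t\<^sup>2 * (y \<bullet> y))"
      using x(2) sa[of x y]
      by (simp add: add scale inner_add_left inner_add_right inner_commute c_def[symmetric]
          norm_eq_1 power2_eq_square algebra_simps)
    moreover have "y \<bullet> f x = y \<bullet> y + c * (x \<bullet> y)"
      by (simp add: y_def inner_diff_left inner_diff_right inner_commute algebra_simps)
    ultimately show ?thesis
      by (simp add: K_def algebra_simps)
  qed
  have "y \<bullet> y = 0"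
  proof (rule ccontr)
    assume "y \<bullet> y \<noteq> 0"
    then have p: "y \<bullet> y > 0" by simp
    \<comment> \<open>Small enough that \<open>t * K \<le> y \<bullet> y\<close>, which contradicts
      \<open>2 * (y \<bullet> y) \<le> t * K\<close>; the \<open>+ 1\<close> keeps the denominator
      positive when \<open>K = 0\<close>.\<close>
    define t where "t = (y \<bullet> y) / (K + 1)"
    have t: "t > 0" using p K by (simp add: t_def)
    have "2 * (y \<bullet> y) \<le> t * K"
      using ineq[of t] t by (simp add: power2_eq_square)
    also have "\<dots> \<le> y \<bullet> y"
      using K p by (simp add: t_def divide_le_eq)
    finally show False using p by simp
  qed
  then have "f x = c *\<^sub>R x" by (simp add: y_def)
  with x show thesis by (rule that)
qed

text \<open>Induction on the dimension: split off a unit eigenvector \<open>x\<close>. Its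
  orthogonal complement in \<open>S\<close> is again invariant, since
  \<open>x \<bullet> f y = f x \<bullet> y = c (x \<bullet> y)\<close>.\<close>

theorem selfadjoint_eigenbasis_of_subspace:
  fixes f :: "'a::euclidean_space \<Rightarrow> 'a"
  assumes f: "linear f" and sa: "\<And>x y. f x \<bullet> y = x \<bullet> f y"
    and "subspace S" and "f ` S \<subseteq> S"
  shows "\<exists>B. pairwise orthogonal B \<and> (\<forall>x\<in>B. norm x = 1 \<and> (\<exists>c. f x = c *\<^sub>R x)) \<and> span B = S"
  using assms(3,4)
proof (induction "dim S" arbitrary: S rule: less_induct)
  case less
  show ?case
  proof (cases "S = {0}")
    case True
    then show ?thesis by (intro exI[of _ "{}"]) auto
  next
    case False
    obtain x c where x: "x \<in> S" "norm x = 1" "f x = c *\<^sub>R x"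
      using selfadjoint_eigenvector_exists[OF f sa less.prems False] by blast
    define T where "T = {y \<in> S. x \<bullet> y = 0}"
    have T: "subspace T"
      using less.prems(1) by (auto simp: T_def subspace_def inner_add_right)
    have "x \<notin> T" using x by (simp add: T_def norm_eq_1)
    then have "T \<subset> S" using x(1) unfolding T_def by blast
    then have "dim T < dim S"
      using T less.prems(1) by (metis dim_psubset span_eq_iff)
    moreover have "f ` T \<subseteq> T"
      using less.prems(2) x(3) by (auto simp: T_def sa[of x, symmetric])
    ultimately obtain B where B: "pairwise orthogonal B"
        "\<forall>x\<in>B. norm x = 1 \<and> (\<exists>c. f x = c *\<^sub>R x)" "span B = T"
      using less.hyps T by blast
    have BT: "B \<subseteq> T" using B(3) span_superset by blast
    have "span (insert x B) = S"
    proof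
      show "span (insert x B) \<subseteq> S"
        using BT x(1) less.prems(1) by (intro span_minimal) (auto simp: T_def)
      show "S \<subseteq> span (insert x B)"
      proof
        fix y assume "y \<in> S"
        then have "y - (x \<bullet> y) *\<^sub>R x \<in> T"
          using x less.prems(1) by (simp add: T_def subspace_diff subspace_scale inner_diff_right norm_eq_1)
        then show "y \<in> span (insert x B)"
          using B(3) span_breakdown_eq by blast
      qed
    qed
    moreover have "pairwise orthogonal (insert x B)"
      using B(1) BT by (auto simp: pairwise_insert T_def orthogonal_def inner_commute)
    ultimately show ?thesis
      using B(2) x by (intro exI[of _ "insert x B"]) auto
  qed
qed

section \<open>Orthonormal families and Bessel's inequality\<close>

text \<open>Families instead of sets, because left and right vectors are paired by index. The index
  set allows a restriction to the positive singular values.\<close>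

definition orthonormal_on :: "'i set \<Rightarrow> ('i \<Rightarrow> 'a::real_inner) \<Rightarrow> bool" where
  "orthonormal_on I e \<longleftrightarrow> (\<forall>i\<in>I. \<forall>j\<in>I. e i \<bullet> e j = (if i = j then 1 else 0))"

lemma orthonormal_on_subset: "orthonormal_on I e \<Longrightarrow> J \<subseteq> I \<Longrightarrow> orthonormal_on J e"
  by (simp add: orthonormal_on_def subset_iff)

lemma inner_sum_orthonormal:
  assumes "orthonormal_on I e" "finite I"
  shows "(\<Sum>i\<in>I. c i *\<^sub>R e i) \<bullet> (\<Sum>i\<in>I. c i *\<^sub>R e i) = (\<Sum>i\<in>I. (c i)\<^sup>2)"
proof -
  have "(\<Sum>i\<in>I. c i *\<^sub>R e i) \<bullet> (\<Sum>i\<in>I. c i *\<^sub>R e i)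
      = (\<Sum>i\<in>I. \<Sum>j\<in>I. if i = j then (c i)\<^sup>2 else 0)"
    unfolding inner_sum_left inner_sum_right
    using assms(1) by (intro sum.cong refl) (auto simp: orthonormal_on_def power2_eq_square)
  then show ?thesis using assms(2) by simp
qed

text \<open>The squared distance from \<open>x\<close> to its projection \<open>y\<close> onto the
  span of the family is nonnegative.\<close>

lemma bessel_inequality:
  assumes e: "orthonormal_on I e" and I: "finite I"
  shows "(\<Sum>i\<in>I. (x \<bullet> e i)\<^sup>2) \<le> x \<bullet> x"
proof -
  define y where "y = (\<Sum>i\<in>I. (x \<bullet> e i) *\<^sub>R e i)"
  have "0 \<le> (x - y) \<bullet> (x - y)" by simp
  also have "\<dots> = x \<bullet> x - 2 * (x \<bullet> y) + y \<bullet> y"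
    by (simp add: inner_diff_left inner_diff_right inner_commute)
  also have "x \<bullet> y = (\<Sum>i\<in>I. (x \<bullet> e i)\<^sup>2)"
    by (simp add: y_def inner_sum_right power2_eq_square)
  also have "y \<bullet> y = (\<Sum>i\<in>I. (x \<bullet> e i)\<^sup>2)"
    unfolding y_def by (rule inner_sum_orthonormal[OF e I])
  finally show ?thesis by simp
qed

text \<open>Applied to the left singular vectors, this bounds the number of positive singular values
  by \<open>CARD('m)\<close>.\<close>

lemma card_orthonormal_le_dim:
  fixes e :: "'i \<Rightarrow> 'a::euclidean_space"
  assumes "orthonormal_on I e"
  shows "card I \<le> DIM('a)"
proof -
  have inj: "inj_on e I"
  proof (rule inj_onI)
    fix i j assume *: "i \<in> I" "j \<in> I" "e i = e j"
    then have "e i \<bullet> e j = 1" using assms by (auto simp: orthonormal_on_def)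
    then show "i = j" using * assms by (metis orthonormal_on_def zero_neq_one)
  qed
  have "pairwise orthogonal (e ` I)"
    using assms by (auto simp: pairwise_def orthogonal_def orthonormal_on_def)
  moreover have "0 \<notin> e ` I"
    using assms by (force simp: orthonormal_on_def)
  ultimately have "independent (e ` I)"
    by (rule pairwise_orthogonal_independent)
  from independent_bound[OF this] show ?thesis
    using inj by (simp add: card_image)
qed

section \<open>Spectral theorem and eigenvalue lists\<close>

text \<open>The case \<open>S = UNIV\<close>. The basis has \<open>CARD('n)\<close> elements and is
  indexed by \<open>'n\<close> itself, so that it can form the columns of a square matrix.\<close>

theorem symmetric_matrix_eigenbasis:
  fixes A :: "real^'n^'n"
  assumes A: "transpose A = A"
  shows "\<exists>(v :: 'n \<Rightarrow> real^'n) \<mu>. orthonormal_on UNIV v \<and> (\<forall>j. A *v v j = \<mu> j *\<^sub>R v j) \<and>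
    (\<forall>x. (\<Sum>j\<in>UNIV. (x \<bullet> v j) *\<^sub>R v j) = x)"
proof -
  have sa: "(A *v x) \<bullet> y = x \<bullet> (A *v y)" for x y
    by (metis A dot_lmul_matrix vector_transpose_matrix)
  obtain B where B: "pairwise orthogonal B"
      "\<And>x. x \<in> B \<Longrightarrow> norm x = 1" "\<And>x. x \<in> B \<Longrightarrow> \<exists>c. A *v x = c *\<^sub>R x" "span B = UNIV"
    using selfadjoint_eigenbasis_of_subspace[of "(*v) A" UNIV] sa by auto
  have "0 \<notin> B" using B(2) by force
  then have ind: "independent B" using B(1) pairwise_orthogonal_independent by blast
  then have fin: "finite B" using independent_bound by blast
  have "card B = CARD('n)"
    using dim_span_eq_card_independent[OF ind] B(4) by simp
  then obtain v :: "'n \<Rightarrow> real^'n" where v: "bij_betw v UNIV B"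
    using fin by (metis finite finite_same_card_bij)
  then have vB: "v j \<in> B" and inj: "v i = v j \<longleftrightarrow> i = j" for i j
    by (auto simp: bij_betw_def inj_eq)
  obtain \<mu> where \<mu>: "\<And>j. A *v v j = \<mu> j *\<^sub>R v j"
    using B(3)[OF vB] by metis
  have "orthonormal_on UNIV v"
    using B(1) B(2)[OF vB] vB inj
    by (auto simp: orthonormal_on_def pairwise_def orthogonal_def norm_eq_1)
  moreover have "(\<Sum>j\<in>UNIV. (x \<bullet> v j) *\<^sub>R v j) = x" for x
  proof -
    have "(\<Sum>j\<in>UNIV. (x \<bullet> v j) *\<^sub>R v j) = (\<Sum>b\<in>B. (x \<bullet> b) *\<^sub>R b)"
      by (rule sum.reindex_bij_betw[OF v])
    also have "\<dots> = x"
      using B fin by (intro orthonormal_basis_expand) auto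
    finally show ?thesis .
  qed
  ultimately show ?thesis using \<mu> by blast
qed

text \<open>Evaluation at \<open>x\<close> is a ring homomorphism and passes through the Leibniz
  expansion of \<open>det\<close>.\<close>

lemma poly_charpoly: "poly (charpoly A) x = det (mat x - A)"
  unfolding charpoly_def det_def
  by (simp add: poly_sum poly_prod mat_def of_int_poly[symmetric] if_distrib[of "\<lambda>p. poly p _"] cong: if_cong)

text \<open>With the eigenvectors as columns of \<open>V\<close>,
  \<open>(mat x - A) ** V = V ** D\<close> for a diagonal \<open>D\<close>. Taking determinants and
  cancelling \<open>det V\<close> gives the identity at every real \<open>x\<close>, hence between
  polynomials.\<close>

lemma charpoly_eigenbasis:
  fixes A :: "real^'n^'n" and v :: "'n \<Rightarrow> real^'n"
  assumes v: "orthonormal_on UNIV v" and ev: "\<And>j. A *v v j = \<mu> j *\<^sub>R v j"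
  shows "charpoly A = (\<Prod>j\<in>UNIV. [:- \<mu> j, 1:])"
proof -
  define V :: "real^'n^'n" where "V = (\<chi> i j. v j $ i)"
  have orth: "transpose V ** V = mat 1"
    using v by (simp add: V_def vec_eq_iff matrix_matrix_mult_def transpose_def mat_def
        orthonormal_on_def inner_vec_def)
  have "poly (charpoly A) x = poly (\<Prod>j\<in>UNIV. [:- \<mu> j, 1:]) x" for x
  proof -
    define D :: "real^'n^'n" where "D = (\<chi> i j. if i = j then x - \<mu> j else 0)"
    have "(\<Sum>k\<in>UNIV. A $ i $ k * v j $ k) = \<mu> j * v j $ i" for i j
      using arg_cong[OF ev[of j], of "\<lambda>w. w $ i"] by (simp add: matrix_vector_mult_def)
    then have "(mat x - A) ** V = V ** D"
      by (simp add: V_def D_def vec_eq_iff matrix_matrix_mult_def mat_def left_diff_distrib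
          sum_subtractf if_distrib[of "\<lambda>t. t * _"] if_distrib[of "\<lambda>t. _ * t"] algebra_simps cong: if_cong)
    then have "det (mat x - A) * det V = det V * det D"
      by (metis det_mul)
    moreover have "det V \<noteq> 0"
      using arg_cong[OF orth, of det] by (auto simp: det_mul)
    ultimately have "det (mat x - A) = det D" by simp
    also have "\<dots> = (\<Prod>j\<in>UNIV. x - \<mu> j)"
      by (subst det_diagonal) (auto simp: D_def)
    finally show ?thesis
      by (simp add: poly_charpoly poly_prod)
  qed
  then show ?thesis
    by (simp add: poly_eq_poly_eq_iff[symmetric] fun_eq_iff)
qed

text \<open>Multisets are compared because \<open>\<mu>\<close> follows the arbitrary order of the
  basis, whereas the list is sorted.\<close>

lemma mset_eigenvalue_list:
  fixes A :: "real^'n^'n" and v :: "'n \<Rightarrow> real^'n"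
  assumes "orthonormal_on UNIV v" "\<And>j. A *v v j = \<mu> j *\<^sub>R v j"
  shows "mset (eigenvalue_list A) = image_mset \<mu> (mset_set UNIV)"
proof -
  have "proots (charpoly A) = (\<Sum>j\<in>UNIV. {#\<mu> j#})"
    unfolding charpoly_eigenbasis[OF assms] by (subst proots_prod) auto
  also have "\<dots> = image_mset \<mu> (mset_set UNIV)"
    by (simp add: sum_unfold_sum_mset)
  finally show ?thesis by (simp add: eigenvalue_list_def)
qed

subsection \<open>Convex functions of singular values\<close>

text \<open>A singular value decomposition with unordered values, indexed by all of
  \<open>'n\<close>. The vectors \<open>u j\<close> are orthonormal only where
  \<open>s j > 0\<close>, since the space of columns may be too small for \<open>CARD('n)\<close>
  orthonormal vectors.\<close>

definition singular_system ::
    "real^'n^'m \<Rightarrow> ('n \<Rightarrow> real^'n) \<Rightarrow> ('n \<Rightarrow> real) \<Rightarrow> ('n \<Rightarrow> real^'m) \<Rightarrow> bool" where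
  "singular_system X v s u \<longleftrightarrow>
     (\<forall>j. s j \<ge> 0) \<and> orthonormal_on UNIV v \<and> orthonormal_on {j. s j > 0} u \<and>
     (\<forall>j. X *v v j = s j *\<^sub>R u j) \<and> (\<forall>x. (\<Sum>j\<in>UNIV. (x \<bullet> v j) *\<^sub>R v j) = x)"

text \<open>For an eigenbasis \<open>v\<close> of \<open>transpose X ** X\<close>, the images
  \<open>X *v v j\<close> are orthogonal with squared norms \<open>\<mu> j\<close>; normalising them
  gives \<open>u\<close>.\<close>

lemma singular_system_exists:
  fixes X :: "real^'n^'m"
  obtains v s u where "singular_system X v s u"
proof -
  have "transpose (transpose X ** X) = transpose X ** X"
    by (simp add: matrix_transpose_mul)
  then obtain v :: "'n \<Rightarrow> real^'n" and \<mu> where v: "orthonormal_on UNIV v"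
    and ev: "\<And>j. (transpose X ** X) *v v j = \<mu> j *\<^sub>R v j"
    and expand: "\<And>x. (\<Sum>j\<in>UNIV. (x \<bullet> v j) *\<^sub>R v j) = x"
    using symmetric_matrix_eigenbasis by blast
  have gram: "(X *v v i) \<bullet> (X *v v j) = (if i = j then \<mu> j else 0)" for i j
  proof -
    have "(X *v v i) \<bullet> (X *v v j) = v i \<bullet> ((transpose X ** X) *v v j)"
      by (metis dot_lmul_matrix inner_commute matrix_vector_mul_assoc vector_transpose_matrix transpose_transpose)
    then show ?thesis
      using v by (simp add: ev orthonormal_on_def)
  qed
  have \<mu>: "\<mu> j \<ge> 0" for j
    using gram[of j j] by (metis inner_ge_zero)
  define s where "s j = sqrt (\<mu> j)" for j
  have s: "s j \<ge> 0" "(s j)\<^sup>2 = \<mu> j" for j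
    using \<mu> by (simp_all add: s_def)
  \<comment> \<open>If \<open>s j = 0\<close>, division by zero makes \<open>u j = 0\<close>, and
    \<open>X *v v j\<close> vanishes as well.\<close>
  define u where "u j = (1 / s j) *\<^sub>R (X *v v j)" for j
  have Xv: "X *v v j = s j *\<^sub>R u j" for j
  proof (cases "s j = 0")
    case True
    then have "(X *v v j) \<bullet> (X *v v j) = 0"
      using s(2)[of j] by (simp add: gram)
    with True show ?thesis by simp
  qed (simp add: u_def)
  have u: "orthonormal_on {j. s j > 0} u"
    by (auto simp: orthonormal_on_def u_def gram s(2)[symmetric] power2_eq_square)
  show thesis
    by (rule that[of v s u]) (use s v u Xv expand in \<open>simp add: singular_system_def\<close>)
qed

context
  fixes X :: "real^'n^'m" and v s u
  assumes sys: "singular_system X v s u"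
begin

lemma singular_system_nonneg: "s j \<ge> 0"
  and singular_system_right: "orthonormal_on UNIV v"
  and singular_system_left: "orthonormal_on {j. s j > 0} u"
  and singular_system_apply: "X *v v j = s j *\<^sub>R u j"
  and singular_system_expand: "(\<Sum>j\<in>UNIV. (x \<bullet> v j) *\<^sub>R v j) = x"
  using sys by (simp_all add: singular_system_def)

lemma singular_system_mult_vec:
  "X *v q = (\<Sum>j | s j > 0. (s j * (q \<bullet> v j)) *\<^sub>R u j)"
proof -
  have "X *v q = X *v (\<Sum>j\<in>UNIV. (q \<bullet> v j) *\<^sub>R v j)"
    by (simp add: singular_system_expand)
  also have "\<dots> = (\<Sum>j\<in>UNIV. (s j * (q \<bullet> v j)) *\<^sub>R u j)"
    by (simp add: linear_sum[OF matrix_vector_mul_linear] o_def matrix_vector_mult_scaleR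
        singular_system_apply mult.commute)
  also have "\<dots> = (\<Sum>j | s j > 0. (s j * (q \<bullet> v j)) *\<^sub>R u j)"
    by (rule sum.mono_neutral_right)
      (use singular_system_nonneg in \<open>auto simp: not_less order.antisym\<close>)
  finally show ?thesis .
qed

lemma singular_system_gram:
  "(X *v v i) \<bullet> (X *v v j) = (if i = j then (s j)\<^sup>2 else 0)"
proof (cases "s i > 0 \<and> s j > 0")
  case True
  then show ?thesis
    using singular_system_left by (simp add: singular_system_apply orthonormal_on_def power2_eq_square)
next
  case False
  then have "s i = 0 \<or> s j = 0"
    using singular_system_nonneg[of i] singular_system_nonneg[of j] by linarith
  then show ?thesis by (auto simp: singular_system_apply)
qed

text \<open>Both sides have the same coordinates in the basis \<open>v\<close>, by the Gram
  relations. This identifies the values of any singular system with those read off from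
  \<open>eigenvalue_list\<close>.\<close>

lemma singular_system_eigenvector:
  "(transpose X ** X) *v v j = (s j)\<^sup>2 *\<^sub>R v j"
proof -
  have "((transpose X ** X) *v v j) \<bullet> v i = (X *v v j) \<bullet> (X *v v i)" for i
    by (metis dot_lmul_matrix matrix_vector_mul_assoc vector_transpose_matrix transpose_transpose)
  then have "((transpose X ** X) *v v j) \<bullet> v i = (if j = i then (s j)\<^sup>2 else 0)" for i
    by (simp add: singular_system_gram)
  then show ?thesis
    using singular_system_expand[of "(transpose X ** X) *v v j"]
    by (simp add: if_distrib[of "\<lambda>c. c *\<^sub>R _"] cong: if_cong)
qed

text \<open>Parseval in the basis \<open>v\<close> for each row of \<open>X\<close>; exchanging the
  sums gives the squared norms of the \<open>X *v v j\<close>.\<close>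

lemma norm_eq_singular_system: "(norm X)\<^sup>2 = (\<Sum>j\<in>UNIV. (s j)\<^sup>2)"
proof -
  have "(norm X)\<^sup>2 = (\<Sum>i\<in>UNIV. X $ i \<bullet> X $ i)"
    by (simp add: power2_norm_eq_inner inner_vec_def)
  also have "\<dots> = (\<Sum>i\<in>UNIV. \<Sum>j\<in>UNIV. (X $ i \<bullet> v j)\<^sup>2)"
  proof (rule sum.cong[OF refl])
    fix i
    show "X $ i \<bullet> X $ i = (\<Sum>j\<in>UNIV. (X $ i \<bullet> v j)\<^sup>2)"
      using inner_sum_orthonormal[OF singular_system_right finite, of "\<lambda>j. X $ i \<bullet> v j"]
      by (simp only: singular_system_expand)
  qed
  also have "\<dots> = (\<Sum>j\<in>UNIV. \<Sum>i\<in>UNIV. (X $ i \<bullet> v j)\<^sup>2)"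
    by (rule sum.swap)
  also have "\<dots> = (\<Sum>j\<in>UNIV. (X *v v j) \<bullet> (X *v v j))"
    by (simp add: inner_vec_def matrix_vector_mult_def power2_eq_square)
  finally show ?thesis by (simp add: singular_system_gram)
qed

end

section \<open>Sums over singular values\<close>

text \<open>A positive entry at a position \<open>i \<ge> k\<close> would make all entries up to
  \<open>i\<close> positive, which is more than \<open>k\<close> of them. So the entries cut off are
  zero, where \<open>h\<close> vanishes.\<close>

lemma sum_take_decreasing:
  fixes L :: "real list" and h :: "real \<Rightarrow> 'a::comm_monoid_add"
  assumes sorted: "sorted (rev L)" and nonneg: "\<And>x. x \<in> set L \<Longrightarrow> x \<ge> 0"
    and k: "k \<le> length L" and card: "size (filter_mset (\<lambda>x. x > 0) (mset L)) \<le> k"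
    and h: "h 0 = 0"
  shows "(\<Sum>i<k. h (L ! i)) = (\<Sum>x\<in>#mset L. h x)"
proof -
  have zero: "L ! i = 0" if i: "k \<le> i" "i < length L" for i
  proof (rule ccontr)
    assume "L ! i \<noteq> 0"
    then have pos: "L ! i > 0" using nonneg[of "L ! i"] i by simp
    have "L ! j > 0" if "j \<le> i" for j
      using sorted_rev_nth_mono[OF sorted that i(2)] pos by simp
    then have "{..i} \<subseteq> {j. j < length L \<and> L ! j > 0}"
      using i(2) by auto
    then have "card {..i} \<le> card {j. j < length L \<and> L ! j > 0}"
      by (intro card_mono) auto
    also have "\<dots> = length (filter (\<lambda>x. x > 0) L)"
      by (simp add: length_filter_conv_card)
    also have "\<dots> = size (filter_mset (\<lambda>x. x > 0) (mset L))"
      by (metis mset_filter size_mset)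
    finally show False using card i by simp
  qed
  have "(\<Sum>i<k. h (L ! i)) = (\<Sum>i<length L. h (L ! i))"
    by (rule sum.mono_neutral_left) (use k zero h in auto)
  also have "\<dots> = (\<Sum>x\<leftarrow>L. h x)"
    by (simp add: sum_list_sum_nth atLeast0LessThan)
  finally show ?thesis
    by (metis mset_map sum_mset_sum_list)
qed

text \<open>Frees sums over singular values from the ordering and from the cut-off at
  \<open>min CARD('m) CARD('n)\<close>, so that any singular system can be used to compute
  them.\<close>

lemma sum_singular_values:
  fixes X :: "real^'n^'m" and h :: "real \<Rightarrow> 'a::comm_monoid_add"
  assumes sys: "singular_system X v s u" and h: "h 0 = 0"
  shows "(\<Sum>i = 1..min CARD('m) CARD('n). h (singular_value X i)) = (\<Sum>j\<in>UNIV. h (s j))"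
proof -
  define L where "L = eigenvalue_list (transpose X ** X)"
  define k where "k = min CARD('m) CARD('n)"
  note s = singular_system_nonneg[OF sys]
  have mL: "mset L = image_mset (\<lambda>j. (s j)\<^sup>2) (mset_set UNIV)"
    unfolding L_def using singular_system_right[OF sys] singular_system_eigenvector[OF sys]
    by (rule mset_eigenvalue_list)
  have len: "length L = CARD('n)"
    using arg_cong[OF mL, of size] by simp
  have "set L = (\<lambda>j. (s j)\<^sup>2) ` UNIV"
    using arg_cong[OF mL, of set_mset] by simp
  then have nonneg: "x \<ge> 0" if "x \<in> set L" for x using that by auto
  have "{#x \<in># mset L. x > 0#} = image_mset (\<lambda>j. (s j)\<^sup>2) (mset_set {j. s j > 0})"
    using s by (simp add: mL filter_mset_image_mset order.strict_iff_order)
  then have card: "size {#x \<in># mset L. x > 0#} = card {j. s j > 0}" by simp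
  also have "\<dots> \<le> CARD('m)"
    using card_orthonormal_le_dim[OF singular_system_left[OF sys]] by simp
  finally have "size {#x \<in># mset L. x > 0#} \<le> k"
    using card card_mono[of UNIV "{j. s j > 0}"] by (simp add: k_def)
  then have "(\<Sum>i<k. h (sqrt (L ! i))) = (\<Sum>x\<in>#mset L. h (sqrt x))"
    by (intro sum_take_decreasing) (use nonneg h len in \<open>auto simp: L_def eigenvalue_list_def k_def\<close>)
  also have "\<dots> = (\<Sum>j\<in>UNIV. h (s j))"
    using s by (simp add: mL sum_unfold_sum_mset image_mset.compositionality o_def)
  \<comment> \<open>Singular values are counted from 1, list positions from 0.\<close>
  also have "(\<Sum>i<k. h (sqrt (L ! i))) = (\<Sum>i = 1..k. h (singular_value X i))"
    unfolding singular_value_def L_def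
    by (rule sum.reindex_bij_witness[of _ "\<lambda>i. i - 1" Suc]) auto
  finally show ?thesis by (simp add: k_def)
qed

section \<open>Convexity of sums over singular values\<close>

text \<open>Jensen's inequality after placing the missing weight at the point 0, where
  \<open>g\<close> vanishes; \<open>None\<close> indexes this extra term.\<close>

lemma convex_on_subconvex_sum:
  fixes g :: "real \<Rightarrow> real"
  assumes g: "convex_on {0..} g" "g 0 = 0" and J: "finite J"
    and w: "\<And>j. j \<in> J \<Longrightarrow> w j \<ge> 0" "(\<Sum>j\<in>J. w j) \<le> 1" and s: "\<And>j. j \<in> J \<Longrightarrow> s j \<ge> 0"
  shows "g (\<Sum>j\<in>J. w j * s j) \<le> (\<Sum>j\<in>J. w j * g (s j))"
proof -
  define W where "W = case_option (1 - (\<Sum>j\<in>J. w j)) w"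
  define S where "S = case_option 0 s"
  let ?J = "insert None (Some ` J)"
  have red: "(\<Sum>i\<in>?J. f i) = f None + (\<Sum>j\<in>J. f (Some j))" for f :: "_ \<Rightarrow> real"
    using J by (subst sum.insert) (auto simp: sum.reindex)
  have "g (\<Sum>i\<in>?J. W i *\<^sub>R S i) \<le> (\<Sum>i\<in>?J. W i * g (S i))"
    by (rule convex_on_sum[OF _ _ g(1)]) (use J w s in \<open>auto simp: red W_def S_def\<close>)
  then show ?thesis
    unfolding red by (simp add: W_def S_def g(2))
qed

text \<open>Row sums at most 1 permit Jensen's inequality for each \<open>i\<close>; column sums at
  most 1 then collapse the double sum, as \<open>g\<close> is nonnegative.\<close>

lemma sum_convex_frame_le:
  fixes X :: "real^'n^'m" and p :: "'i \<Rightarrow> real^'m" and q :: "'i \<Rightarrow> real^'n"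
  assumes g: "convex_on {0..} g" "mono_on {0..} g" "g 0 = 0"
    and I: "finite I" and p: "orthonormal_on I p" and q: "orthonormal_on I q"
  shows "(\<Sum>i\<in>I. g \<bar>p i \<bullet> (X *v q i)\<bar>)
    \<le> (\<Sum>i = 1..min CARD('m) CARD('n). g (singular_value X i))"
proof -
  obtain v s u where sys: "singular_system X v s u"
    by (rule singular_system_exists)
  note s = singular_system_nonneg[OF sys]
  define J where "J = {j. s j > 0}"
  have vJ: "orthonormal_on J v"
    by (rule orthonormal_on_subset[OF singular_system_right[OF sys]]) simp
  note uJ = singular_system_left[OF sys, folded J_def]
  define w where "w i j = ((p i \<bullet> u j)\<^sup>2 + (q i \<bullet> v j)\<^sup>2) / 2" for i j
  have w0: "w i j \<ge> 0" for i j by (simp add: w_def)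
  have row: "(\<Sum>j\<in>J. w i j) \<le> 1" if "i \<in> I" for i
    \<comment> \<open>Each half of the row is a Bessel sum of a unit vector, \<open>p i\<close> or
      \<open>q i\<close>. For the columns the roles of the families are exchanged.\<close>
    using bessel_inequality[OF uJ finite, of "p i"] bessel_inequality[OF vJ finite, of "q i"] p q that
    by (simp add: w_def sum.distrib sum_divide_distrib[symmetric] orthonormal_on_def)
  have column: "(\<Sum>i\<in>I. w i j) \<le> 1" if "j \<in> J" for j
    using bessel_inequality[OF p I, of "u j"] bessel_inequality[OF q I, of "v j"] uJ vJ that
    by (simp add: w_def sum.distrib sum_divide_distrib[symmetric] orthonormal_on_def inner_commute)
  have g0: "g (s j) \<ge> 0" for j
    using mono_onD[OF g(2), of 0 "s j"] s[of j] g(3) by simp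
  have "g \<bar>p i \<bullet> (X *v q i)\<bar> \<le> (\<Sum>j\<in>J. w i j * g (s j))" if i: "i \<in> I" for i
  proof -
    have "\<bar>p i \<bullet> (X *v q i)\<bar> = \<bar>\<Sum>j\<in>J. s j * ((p i \<bullet> u j) * (q i \<bullet> v j))\<bar>"
      by (simp add: singular_system_mult_vec[OF sys] J_def inner_sum_right mult_ac)
    also have "\<dots> \<le> (\<Sum>j\<in>J. \<bar>s j * ((p i \<bullet> u j) * (q i \<bullet> v j))\<bar>)"
      by (rule sum_abs)
    also have "\<dots> \<le> (\<Sum>j\<in>J. w i j * s j)"
    proof (rule sum_mono)
      fix j
      have "\<bar>(p i \<bullet> u j) * (q i \<bullet> v j)\<bar> \<le> w i j"
        using sum_squares_bound[of "\<bar>p i \<bullet> u j\<bar>" "\<bar>q i \<bullet> v j\<bar>"] by (simp add: w_def abs_mult)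
      from mult_left_mono[OF this s[of j]]
      show "\<bar>s j * ((p i \<bullet> u j) * (q i \<bullet> v j))\<bar> \<le> w i j * s j"
        using s[of j] by (simp add: abs_mult mult.commute)
    qed
    finally have "g \<bar>p i \<bullet> (X *v q i)\<bar> \<le> g (\<Sum>j\<in>J. w i j * s j)"
      by (intro mono_onD[OF g(2)]) (auto intro!: sum_nonneg simp: w0 s)
    also have "\<dots> \<le> (\<Sum>j\<in>J. w i j * g (s j))"
      by (rule convex_on_subconvex_sum[OF g(1,3)]) (use w0 s row[OF i] in auto)
    finally show ?thesis .
  qed
  then have "(\<Sum>i\<in>I. g \<bar>p i \<bullet> (X *v q i)\<bar>) \<le> (\<Sum>i\<in>I. \<Sum>j\<in>J. w i j * g (s j))"
    by (rule sum_mono)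
  also have "\<dots> = (\<Sum>j\<in>J. (\<Sum>i\<in>I. w i j) * g (s j))"
    by (subst sum.swap) (simp add: sum_distrib_right)
  also have "\<dots> \<le> (\<Sum>j\<in>J. 1 * g (s j))"
    by (intro sum_mono mult_right_mono column g0)
  also have "\<dots> \<le> (\<Sum>j\<in>UNIV. g (s j))"
    by (simp, intro sum_mono2) (auto simp: g0)
  also have "\<dots> = (\<Sum>i = 1..min CARD('m) CARD('n). g (singular_value X i))"
    using sum_singular_values[OF sys, of g] g(3) by simp
  finally show ?thesis .
qed

theorem convex_on_sum_singular_values:
  assumes g: "convex_on {0..} g" "mono_on {0..} g" "g 0 = 0"
  shows "convex_on UNIV
    (\<lambda>X :: real^'n^'m. \<Sum>i = 1..min CARD('m) CARD('n). g (singular_value X i))"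
    (is "convex_on UNIV ?F")
proof (rule convex_onI)
  fix t :: real and X Z :: "real^'n^'m"
  assume t: "0 < t" "t < 1"
  \<comment> \<open>The frame is taken from the singular vectors of the combination itself: it
    attains the maximum at \<open>C\<close> and gives lower bounds for the sums at \<open>X\<close>
    and \<open>Z\<close>.\<close>
  define C where "C = (1 - t) *\<^sub>R X + t *\<^sub>R Z"
  obtain v s u where sys: "singular_system C v s u"
    by (rule singular_system_exists)
  note s = singular_system_nonneg[OF sys]
  define J where "J = {j. s j > 0}"
  have vJ: "orthonormal_on J v"
    by (rule orthonormal_on_subset[OF singular_system_right[OF sys]]) simp
  note uJ = singular_system_left[OF sys, folded J_def]
  let ?x = "\<lambda>j. \<bar>u j \<bullet> (X *v v j)\<bar>" and ?z = "\<lambda>j. \<bar>u j \<bullet> (Z *v v j)\<bar>"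
  have "?F C = (\<Sum>j\<in>UNIV. g (s j))"
    using sum_singular_values[OF sys, of g] g(3) by simp
  also have "\<dots> = (\<Sum>j\<in>J. g (s j))"
    by (rule sum.mono_neutral_right) (use s g(3) in \<open>auto simp: J_def less_le\<close>)
  also have "\<dots> \<le> (\<Sum>j\<in>J. (1 - t) * g (?x j) + t * g (?z j))"
  proof (rule sum_mono)
    fix j assume j: "j \<in> J"
    \<comment> \<open>For fixed vectors this expression is linear in the matrix. The absolute values
      then bring the arguments into \<open>{0..}\<close>, where \<open>g\<close> is monotone and
      convex.\<close>
    have "s j = u j \<bullet> (C *v v j)"
      using uJ j by (simp add: singular_system_apply[OF sys] orthonormal_on_def)
    also have "\<dots> = (1 - t) * (u j \<bullet> (X *v v j)) + t * (u j \<bullet> (Z *v v j))"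
      by (simp add: C_def matrix_vector_mult_add_rdistrib scaleR_matrix_vector_assoc[symmetric] inner_add_right)
    also have "\<dots> \<le> (1 - t) * ?x j + t * ?z j"
      using t by (intro add_mono mult_left_mono) auto
    finally have "g (s j) \<le> g ((1 - t) * ?x j + t * ?z j)"
      using s t by (intro mono_onD[OF g(2)]) auto
    also have "\<dots> \<le> (1 - t) * g (?x j) + t * g (?z j)"
      using convex_onD[OF g(1), of t "?x j" "?z j"] t by simp
    finally show "g (s j) \<le> (1 - t) * g (?x j) + t * g (?z j)" .
  qed
  also have "\<dots> = (1 - t) * (\<Sum>j\<in>J. g (?x j)) + t * (\<Sum>j\<in>J. g (?z j))"
    by (simp add: sum.distrib sum_distrib_left)
  also have "\<dots> \<le> (1 - t) * ?F X + t * ?F Z"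
    using t by (intro add_mono mult_left_mono sum_convex_frame_le[OF g finite uJ vJ]) auto
  finally show "?F ((1 - t) *\<^sub>R X + t *\<^sub>R Z) \<le> (1 - t) * ?F X + t * ?F Z"
    by (simp only: C_def)
qed simp

section \<open>Convexity of the penalty plus a square\<close>

text \<open>Shifting both points by \<open>e > 0\<close> shifts their convex combination by
  \<open>e\<close> too; then let \<open>e\<close> tend to 0.\<close>

lemma convex_on_atLeast_of_greaterThan:
  fixes f :: "real \<Rightarrow> real"
  assumes c: "continuous_on {0..} f" and f: "convex_on {0<..} f"
  shows "convex_on {0..} f"
proof (rule convex_onI)
  fix t x y :: real
  assume t: "0 < t" "t < 1" and xy: "x \<in> {0..}" "y \<in> {0..}"
  let ?z = "(1 - t) *\<^sub>R x + t *\<^sub>R y"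
  have z: "?z \<in> {0..}" using t xy by simp
  have lim: "((\<lambda>e. f (w + e)) \<longlongrightarrow> f w) (at_right 0)" if "w \<in> {0..}" for w
  proof -
    have "((\<lambda>e. w + e) \<longlongrightarrow> w + 0) (at_right 0)"
      by (intro tendsto_intros)
    then show ?thesis
      by (intro continuous_on_tendsto_compose[OF c _ that])
        (use that in \<open>auto simp: eventually_at_filter intro!: always_eventually\<close>)
  qed
  show "f ?z \<le> (1 - t) * f x + t * f y"
  proof (rule tendsto_le)
    show "((\<lambda>e. (1 - t) * f (x + e) + t * f (y + e)) \<longlongrightarrow> (1 - t) * f x + t * f y) (at_right 0)"
      using xy by (intro tendsto_intros lim)
    show "((\<lambda>e. f (?z + e)) \<longlongrightarrow> f ?z) (at_right 0)"
      by (rule lim[OF z])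
    show "\<forall>\<^sub>F e in at_right 0. f (?z + e) \<le> (1 - t) * f (x + e) + t * f (y + e)"
      using eventually_at_right_less[of "0::real"]
    proof eventually_elim
      case (elim e)
      have "?z + e = (1 - t) *\<^sub>R (x + e) + t *\<^sub>R (y + e)"
        by (simp add: algebra_simps)
      then show ?case
        using convex_onD[OF f, of t "x + e" "y + e"] t xy elim by simp
    qed
  qed simp
qed simp

text \<open>For \<open>x > 0\<close>, \<open>g'' = \<phi>'' + a \<ge> 0\<close> by the infimum
  condition and \<open>g' = \<phi>' + a x \<ge> 0\<close>; continuity includes the endpoint 0.
  Subtracting \<open>\<phi> 0\<close> makes \<open>g 0 = 0\<close>.\<close>

lemma nonconvex_penalty_plus_square:
  assumes \<phi>: "nonconvex_penalty \<phi> a" and a: "a \<ge> 0"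
  defines "g \<equiv> \<lambda>x. \<phi> x - \<phi> 0 + a / 2 * x\<^sup>2"
  shows "convex_on {0..} g" "mono_on {0..} g"
proof -
  have cont: "continuous_on UNIV \<phi>"
    and d1: "\<And>x. x > 0 \<Longrightarrow> \<phi> differentiable (at x)"
    and d1_nonneg: "\<And>x. x > 0 \<Longrightarrow> deriv \<phi> x \<ge> 0"
    and d2: "\<And>x. x > 0 \<Longrightarrow> deriv \<phi> differentiable (at x)"
    and bdd: "bdd_below (deriv (deriv \<phi>) ` (- {0}))"
    and inf: "(INF x\<in>- {0}. deriv (deriv \<phi>) x) = - a"
    using \<phi> by (auto simp: nonconvex_penalty_def)
  have D1: "(\<phi> has_real_derivative deriv \<phi> x) (at x)" if "x > 0" for x
    using d1[OF that] DERIV_deriv_iff_real_differentiable by blast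
  have D2: "(deriv \<phi> has_real_derivative deriv (deriv \<phi>) x) (at x)" if "x > 0" for x
    using d2[OF that] DERIV_deriv_iff_real_differentiable by blast
  have ge: "deriv (deriv \<phi>) x \<ge> - a" if "x > 0" for x
    unfolding inf[symmetric] by (rule cINF_lower[OF bdd]) (use that in auto)
  have gD: "(g has_real_derivative deriv \<phi> x + a * x) (at x)" if "x > 0" for x
    unfolding g_def by (rule derivative_eq_intros D1[OF that] refl | simp)+
  have gD2: "((\<lambda>x. deriv \<phi> x + a * x) has_real_derivative deriv (deriv \<phi>) x + a) (at x)"
    if "x > 0" for x
    by (rule derivative_eq_intros D2[OF that] refl | simp)+
  have contg: "continuous_on A g" for A
    unfolding g_def by (intro continuous_intros continuous_on_subset[OF cont]) auto
  have "convex_on {0<..} g"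
    by (rule f''_ge0_imp_convex[OF _ gD gD2]) (use ge in force)+
  then show "convex_on {0..} g"
    by (rule convex_on_atLeast_of_greaterThan[OF contg])
  show "mono_on {0..} g"
  proof (rule mono_onI)
    fix x y :: real assume xy: "x \<in> {0..}" "y \<in> {0..}" "x \<le> y"
    show "g x \<le> g y"
    proof (rule DERIV_nonneg_imp_increasing_open[OF xy(3)])
      fix z assume "x < z" "z < y"
      then have "z > 0" using xy by simp
      then show "\<exists>d. (g has_real_derivative d) (at z) \<and> d \<ge> 0"
        using gD[of z] d1_nonneg[of z] a by (intro exI[of _ "deriv \<phi> z + a * z"]) simp
    qed (rule contg)
  qed
qed

section \<open>Strict convexity of the objective\<close>

lemma sum_squares_singular_values:
  fixes X :: "real^'n^'m"
  shows "(\<Sum>i = 1..min CARD('m) CARD('n). (singular_value X i)\<^sup>2) = (norm X)\<^sup>2"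
proof -
  obtain v s u where "singular_system X v s u"
    by (rule singular_system_exists)
  then show ?thesis
    using sum_singular_values[of X v s u "\<lambda>x. x\<^sup>2"] by (simp add: norm_eq_singular_system)
qed

text \<open>The last term is the exact convexity gap of the squared norm, from which strictness will
  come.\<close>

lemma norm_square_convex_combination:
  fixes x y :: "'a::real_inner" and u v :: real
  assumes "u + v = 1"
  shows "(norm (u *\<^sub>R x + v *\<^sub>R y))\<^sup>2 = u * (norm x)\<^sup>2 + v * (norm y)\<^sup>2 - u * v * (norm (x - y))\<^sup>2"
proof -
  have v: "v = 1 - u" using assms by simp
  show ?thesis
    unfolding v power2_norm_eq_inner
    by (simp add: inner_add_left inner_add_right inner_diff_left inner_diff_right inner_commute algebra_simps)
qed

theorem theorem1:
  fixes Y :: "real^'n^'m" and \<phi> :: "real \<Rightarrow> real \<Rightarrow> real" and a lam :: real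
  assumes "lam > 0"
    and "nonconvex_penalty (\<lambda>x. \<phi> x a) a"
    and "0 \<le> a" and "a < 1 / lam"
  shows "strictly_convex_on UNIV
    (\<lambda>X :: real^'n^'m. 1 / 2 * (norm (Y - X))\<^sup>2 +
       lam * (\<Sum>i = 1..min CARD('m) CARD('n). \<phi> (singular_value X i) a))"
proof -
  define k where "k = min CARD('m) CARD('n)"
  define g where "g = (\<lambda>x. \<phi> x a - \<phi> 0 a + a / 2 * x\<^sup>2)"
  define F where "F = (\<lambda>X :: real^'n^'m. \<Sum>i = 1..k. g (singular_value X i))"
  have g: "convex_on {0..} g" "mono_on {0..} g" "g 0 = 0"
    using nonconvex_penalty_plus_square[OF assms(2,3)] by (simp_all add: g_def)
  have F: "convex_on UNIV F"
    unfolding F_def k_def by (rule convex_on_sum_singular_values[OF g])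
  have la: "lam * a < 1"
    using assms(1,4) by (simp add: pos_less_divide_eq mult.commute)
  have penalty: "(\<Sum>i = 1..k. \<phi> (singular_value X i) a) = F X + k * \<phi> 0 a - a / 2 * (norm X)\<^sup>2"
    for X :: "real^'n^'m"
  proof -
    have "F X = (\<Sum>i = 1..k. \<phi> (singular_value X i) a) - k * \<phi> 0 a
        + a / 2 * (\<Sum>i = 1..k. (singular_value X i)\<^sup>2)"
      by (simp add: F_def g_def sum.distrib sum_subtractf sum_distrib_left)
    then show ?thesis
      using sum_squares_singular_values[of X] by (simp add: k_def)
  qed
  have "1 / 2 * (norm (Y - (u *\<^sub>R X + v *\<^sub>R Z)))\<^sup>2
        + lam * (F (u *\<^sub>R X + v *\<^sub>R Z) + k * \<phi> 0 a - a / 2 * (norm (u *\<^sub>R X + v *\<^sub>R Z))\<^sup>2)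
      < u * (1 / 2 * (norm (Y - X))\<^sup>2 + lam * (F X + k * \<phi> 0 a - a / 2 * (norm X)\<^sup>2))
        + v * (1 / 2 * (norm (Y - Z))\<^sup>2 + lam * (F Z + k * \<phi> 0 a - a / 2 * (norm Z)\<^sup>2))"
    if uv: "u > 0" "v > 0" "u + v = 1" and ne: "X \<noteq> Z" for u v :: real and X Z :: "real^'n^'m"
  proof -
    have "Y - (u *\<^sub>R X + v *\<^sub>R Z) = u *\<^sub>R (Y - X) + v *\<^sub>R (Y - Z)"
      by (simp add: eq_diff_eq[THEN iffD2, OF uv(3)] algebra_simps)
    then have 1: "(norm (Y - (u *\<^sub>R X + v *\<^sub>R Z)))\<^sup>2
        = u * (norm (Y - X))\<^sup>2 + v * (norm (Y - Z))\<^sup>2 - u * v * (norm (X - Z))\<^sup>2"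
      using norm_square_convex_combination[OF uv(3), of "Y - X" "Y - Z"] by (simp add: norm_minus_commute)
    have "F (u *\<^sub>R X + v *\<^sub>R Z) \<le> u * F X + v * F Z"
      using F uv by (simp add: convex_on_def)
    then have 2: "lam * F (u *\<^sub>R X + v *\<^sub>R Z) \<le> lam * (u * F X + v * F Z)"
      using assms(1) by simp
    \<comment> \<open>Twice the strict gap: the data term contributes \<open>1/2\<close> and the
      subtracted square \<open>- lam * a / 2\<close> times
      \<open>u * v * (norm (X - Z))\<^sup>2\<close>.\<close>
    have 3: "(1 - lam * a) * (u * v * (norm (X - Z))\<^sup>2) > 0"
      using la uv ne by simp
    \<comment> \<open>The constant shifts cancel because \<open>u + v = 1\<close>; stated
      separately, as the products with \<open>u\<close> and \<open>v\<close> are nonlinear.\<close>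
    have 4: "u * (lam * (k * \<phi> 0 a)) + v * (lam * (k * \<phi> 0 a)) = lam * (k * \<phi> 0 a)"
      by (simp add: distrib_right[symmetric] uv(3))
    show ?thesis
      unfolding 1 norm_square_convex_combination[OF uv(3), of X Z]
      using 2 3 4 by (simp add: algebra_simps)
  qed
  then show ?thesis
    unfolding strictly_convex_on_def k_def[symmetric] penalty by simp
qed

end
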